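(* Let $\gamma_D\in(0,\frac1L]$, $\rho_D>0$, and put $b_1=\frac1{\rho_D\gamma_D}$, $b_2=\frac{\rho_D^2\gamma_D^2}{(\rho_D+1)^3}+\frac{\rho_D^2\gamma_D^2}{2(\rho_D+1)^2}$, $b_3=\frac{\rho_D\gamma_D}{(\rho_D+1)^2}+\frac{\rho_D\gamma_D}{\rho_D+1}$. Consider the problem (P): minimize $E(\mathbf K,B)$ over real $\mathbf K=(K_0,\dots,K_N)\succ\mathbf 0$, $B>0$ subject to $T(\mathbf K,B)\le T_{\max}$ and $$\frac{b_1c_1}{\ln\left(\frac{K_0+\rho_D+1}{\rho_D+1}\right)\sum_{n\in\mathcal N}K_n}+\frac{b_2c_2\max_{n\in\mathcal N}K_n^2}{\ln\left(\frac{K_0+\rho_D+1}{\rho_D+1}\right)}+\frac{b_3c_3}{B\ln\left(\frac{K_0+\rho_D+1}{\rho_D+1}\right)}+\frac{b_3c_4\sum_{n\in\mathcal N}q_{s_0,s_n}K_n^2}{\ln\left(\frac{K_0+\rho_D+1}{\rho_D+1}\right)\sum_{n\in\mathcal N}K_n}\le C_{\max},$$ and the problem (P'): minimize $E(\mathbf K,B)$ over real $\mathbf K\succ\mathbf 0$, $B,T_1,T_2>0$ subject to $$\frac{C_n}{F_n}K_nT_1^{-1}\le1,\quad K_nT_2^{-1}\le1,\quad n\in\mathcal N,$$ $$\left(\frac{C_0}{F_0}+\max_{n\in\mathcal N}\frac{M_{s_n}}{r_n}+\frac{M_{s_0}}{r_0}+BT_1\right)\frac{K_0}{T_{\max}}\le1,$$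 $$\frac{b_1c_1K_0}{\sum_{n\in\mathcal N}K_n}+b_2c_2T_2^2K_0+\frac{b_3c_3K_0}{B}+\frac{b_3c_4K_0\sum_{n\in\mathcal N}q_{s_0,s_n}K_n^2}{\sum_{n\in\mathcal N}K_n}\le C_{\max}K_0\ln\left(\frac{K_0+\rho_D+1}{\rho_D+1}\right).$$ If $(\mathbf K^*,B^*,T_1^*,T_2^* )$ is an optimal point of (P'), then $(\mathbf K^*,B^* )$ is an optimal point of (P).
   Context: $N\in\mathbb Z_+$, $\mathcal N=\{1,\dots,N\}$, $\bar{\mathcal N}=\{0\}\cup\mathcal N$. All of the following are given positive real constants: $L$; $C_n,F_n,\alpha_n,p_n,r_n,M_{s_n}$ ($n\in\bar{\mathcal N}$); $q_{s_0,s_n}$ ($n\in\mathcal N$); $c_1,c_2,c_3,c_4$; $T_{\max},C_{\max}$. For $\mathbf K=(K_0,\dots,K_N)\succ\mathbf 0$ (componentwise positive) and $B>0$: $$T(\mathbf K,B)=K_0\left(B\max_{n\in\mathcal N}\frac{C_n}{F_n}K_n+\frac{C_0}{F_0}+\max_{n\in\mathcal N}\frac{M_{s_n}}{r_n}+\frac{M_{s_0}}{r_0}\right),$$ $$E(\mathbf K,B)=K_0\left(B\sum_{n\in\mathcal N}\alpha_nC_nF_n^2K_n+\alpha_0C_0F_0^2+\sum_{n\in\bar{\mathcal N}}\frac{p_nM_{s_n}}{r_n}\right).$$ An optimal point is a feasible point attaining the minimum (global optimum). *)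

theory Defs
  imports Complex_Main "HOL-Library.FuncSet"
begin

text \<open>
  The given constants. Index 0 is the server, indices 1, ..., num_workers are the workers.
  The fields L, C, F, alpha, p, r, M_s and q_s of the usual notation are called here
  smoothness, cycles, freq, capacitance, power, rate, msg_bits and quant_var;
  quant_var n stands for the constant indexed by the pair (s_0, s_n).
  Only the values on the relevant index ranges matter.
\<close>

record fl_system =
  num_workers :: nat
  smoothness :: real
  cycles :: "nat \<Rightarrow> real"
  freq :: "nat \<Rightarrow> real"
  capacitance :: "nat \<Rightarrow> real"
  power :: "nat \<Rightarrow> real"
  rate :: "nat \<Rightarrow> real"
  msg_bits :: "nat \<Rightarrow> real"
  quant_var :: "nat \<Rightarrow> real"
  c1 :: real
  c2 :: real
  c3 :: real
  c4 :: real
  T_max :: real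
  C_max :: real

definition valid_system :: "fl_system \<Rightarrow> bool" where
  "valid_system S \<longleftrightarrow>
     num_workers S \<ge> 1 \<and> smoothness S > 0 \<and>
     (\<forall>n\<in>{0..num_workers S}.
        cycles S n > 0 \<and> freq S n > 0 \<and> capacitance S n > 0 \<and>
        power S n > 0 \<and> rate S n > 0 \<and> msg_bits S n > 0) \<and>
     (\<forall>n\<in>{1..num_workers S}. quant_var S n > 0) \<and>
     c1 S > 0 \<and> c2 S > 0 \<and> c3 S > 0 \<and> c4 S > 0 \<and> T_max S > 0 \<and> C_max S > 0"

definition time_cost :: "fl_system \<Rightarrow> (nat \<Rightarrow> real) \<Rightarrow> real \<Rightarrow> real" where
  "time_cost S K B =
     K 0 * (B * (MAX n\<in>{1..num_workers S}. cycles S n / freq S n * K n)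
            + cycles S 0 / freq S 0
            + (MAX n\<in>{1..num_workers S}. msg_bits S n / rate S n)
            + msg_bits S 0 / rate S 0)"

definition energy_cost :: "fl_system \<Rightarrow> (nat \<Rightarrow> real) \<Rightarrow> real \<Rightarrow> real" where
  "energy_cost S K B =
     K 0 * (B * (\<Sum>n\<in>{1..num_workers S}. capacitance S n * cycles S n * (freq S n)^2 * K n)
            + capacitance S 0 * cycles S 0 * (freq S 0)^2
            + (\<Sum>n\<in>{0..num_workers S}. power S n * msg_bits S n / rate S n))"

definition b1 :: "real \<Rightarrow> real \<Rightarrow> real" where
  "b1 \<gamma> \<rho> = 1 / (\<rho> * \<gamma>)"

definition b2 :: "real \<Rightarrow> real \<Rightarrow> real" where
  "b2 \<gamma> \<rho> = \<rho>^2 * \<gamma>^2 / (\<rho> + 1)^3 + \<rho>^2 * \<gamma>^2 / (2 * (\<rho> + 1)^2)"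

definition b3 :: "real \<Rightarrow> real \<Rightarrow> real" where
  "b3 \<gamma> \<rho> = \<rho> * \<gamma> / (\<rho> + 1)^2 + \<rho> * \<gamma> / (\<rho> + 1)"

definition conv_error :: "fl_system \<Rightarrow> real \<Rightarrow> real \<Rightarrow> (nat \<Rightarrow> real) \<Rightarrow> real \<Rightarrow> real" where
  "conv_error S \<gamma> \<rho> K B =
     b1 \<gamma> \<rho> * c1 S / (ln ((K 0 + \<rho> + 1) / (\<rho> + 1)) * (\<Sum>n\<in>{1..num_workers S}. K n))
     + b2 \<gamma> \<rho> * c2 S * (MAX n\<in>{1..num_workers S}. (K n)^2) / ln ((K 0 + \<rho> + 1) / (\<rho> + 1))
     + b3 \<gamma> \<rho> * c3 S / (B * ln ((K 0 + \<rho> + 1) / (\<rho> + 1)))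
     + b3 \<gamma> \<rho> * c4 S * (\<Sum>n\<in>{1..num_workers S}. quant_var S n * (K n)^2)
         / (ln ((K 0 + \<rho> + 1) / (\<rho> + 1)) * (\<Sum>n\<in>{1..num_workers S}. K n))"

text \<open>
  A vector (K_0, ..., K_N) is an extensional function on \<open>{0..N}\<close>, so that points of the
  search space correspond one-to-one to real vectors of length N + 1.
\<close>

definition feasible_P ::
  "fl_system \<Rightarrow> real \<Rightarrow> real \<Rightarrow> (nat \<Rightarrow> real) \<times> real \<Rightarrow> bool" where
  "feasible_P S \<gamma> \<rho> = (\<lambda>(K, B).
     K \<in> {0..num_workers S} \<rightarrow>\<^sub>E {0<..} \<and> B > 0 \<and>
     time_cost S K B \<le> T_max S \<and>
     conv_error S \<gamma> \<rho> K B \<le> C_max S)"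

definition feasible_P' ::
  "fl_system \<Rightarrow> real \<Rightarrow> real \<Rightarrow> (nat \<Rightarrow> real) \<times> real \<times> real \<times> real \<Rightarrow> bool" where
  "feasible_P' S \<gamma> \<rho> = (\<lambda>(K, B, T1, T2).
     K \<in> {0..num_workers S} \<rightarrow>\<^sub>E {0<..} \<and> B > 0 \<and> T1 > 0 \<and> T2 > 0 \<and>
     (\<forall>n\<in>{1..num_workers S}. cycles S n / freq S n * K n * inverse T1 \<le> 1) \<and>
     (\<forall>n\<in>{1..num_workers S}. K n * inverse T2 \<le> 1) \<and>
     (cycles S 0 / freq S 0 + (MAX n\<in>{1..num_workers S}. msg_bits S n / rate S n)
        + msg_bits S 0 / rate S 0 + B * T1) * (K 0 / T_max S) \<le> 1 \<and>
     b1 \<gamma> \<rho> * c1 S * K 0 / (\<Sum>n\<in>{1..num_workers S}. K n)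
       + b2 \<gamma> \<rho> * c2 S * T2^2 * K 0
       + b3 \<gamma> \<rho> * c3 S * K 0 / B
       + b3 \<gamma> \<rho> * c4 S * K 0 * (\<Sum>n\<in>{1..num_workers S}. quant_var S n * (K n)^2)
           / (\<Sum>n\<in>{1..num_workers S}. K n)
     \<le> C_max S * K 0 * ln ((K 0 + \<rho> + 1) / (\<rho> + 1)))"

definition optimal_P ::
  "fl_system \<Rightarrow> real \<Rightarrow> real \<Rightarrow> (nat \<Rightarrow> real) \<times> real \<Rightarrow> bool" where
  "optimal_P S \<gamma> \<rho> = is_arg_min (\<lambda>(K, B). energy_cost S K B) (feasible_P S \<gamma> \<rho>)"

definition optimal_P' ::
  "fl_system \<Rightarrow> real \<Rightarrow> real \<Rightarrow> (nat \<Rightarrow> real) \<times> real \<times> real \<times> real \<Rightarrow> bool" where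
  "optimal_P' S \<gamma> \<rho> = is_arg_min (\<lambda>(K, B, T1, T2). energy_cost S K B) (feasible_P' S \<gamma> \<rho>)"

end

theory Submission
  imports Defs
begin

text \<open>
  The point \<open>(K, B)\<close> is feasible for (P) iff it extends to a feasible point of (P'):
  \<open>T1\<close> and \<open>T2\<close> are upper bounds for the two maxima, both of which enter the
  constraints of (P) monotonically, so that the maxima themselves are the best choice; and the
  two error constraints differ by the positive factor \<open>K 0 * ln ((K 0 + \<rho> + 1) / (\<rho> + 1))\<close>.
  Since the objectives do not involve \<open>T1\<close> and \<open>T2\<close>, optimality transfers.
\<close>

text \<open>Multiplying the second inequality by \<open>k * l > 0\<close> gives the first. The
  letter \<open>m\<close> is a placeholder for the quantity multiplying \<open>b2 * c2\<close>, so
  that it can be the squared maximum of (P).\<close>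

lemma scaled_error_le_iff:
  fixes a b d e m q s B C k l :: real
  assumes "k > 0" "l > 0"
  shows "a * k / s + b * m * k + d * k / B + e * k * q / s \<le> C * k * l \<longleftrightarrow>
         a / (l * s) + b * m / l + d / (B * l) + e * q / (l * s) \<le> C"
proof -
  have "a * k / s + b * m * k + d * k / B + e * k * q / s =
        (k * l) * (a / (l * s) + b * m / l + d / (B * l) + e * q / (l * s))"
    using assms by (simp add: distrib_left mult_ac)
  moreover have "C * k * l = (k * l) * C"
    by simp
  ultimately show ?thesis
    using assms by (simp only: mult_le_cancel_left_pos mult_pos_pos)
qed

text \<open>Squaring is monotone on nonnegative reals, so an element attaining the maximum of
  \<open>f\<close> also attains that of its square. This links the squared entries in (P) to the
  single bound \<open>T2^2\<close> in (P').\<close>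

lemma Max_power2_image:
  fixes f :: "'a \<Rightarrow> real"
  assumes "finite A" "A \<noteq> {}" "\<And>x. x \<in> A \<Longrightarrow> f x \<ge> 0"
  shows "(MAX x\<in>A. (f x)^2) = (MAX x\<in>A. f x)^2"
proof (rule Max_eqI)
  have "(MAX x\<in>A. f x) \<in> f ` A"
    using assms by (intro Max_in) auto
  then show "(MAX x\<in>A. f x)^2 \<in> (\<lambda>x. (f x)^2) ` A"
    by auto
qed (use assms in \<open>auto intro!: power_mono\<close>)

lemma feasible_P_iff:
  assumes S: "valid_system S" and \<rho>: "\<rho> > 0"
  shows "feasible_P S \<gamma> \<rho> (K, B) \<longleftrightarrow> (\<exists>T1 T2. feasible_P' S \<gamma> \<rho> (K, B, T1, T2))"
proof (cases "K \<in> {0..num_workers S} \<rightarrow>\<^sub>E {0<..} \<and> B > 0")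
  case False
  then show ?thesis
    by (auto simp: feasible_P_def feasible_P'_def)
next
  case True
  define W where "W = {1..num_workers S}"
  define \<tau> where "\<tau> = (MAX n\<in>W. cycles S n / freq S n * K n)"
  define \<kappa> where "\<kappa> = (MAX n\<in>W. K n)"
  define l where "l = ln ((K 0 + \<rho> + 1) / (\<rho> + 1))"
  define D where "D = cycles S 0 / freq S 0 + (MAX n\<in>W. msg_bits S n / rate S n)
    + msg_bits S 0 / rate S 0"
  \<comment> \<open>One function serves both problems: (P) takes \<open>m\<close> to be
    \<open>\<kappa>^2\<close>, (P') takes it to be \<open>T2^2\<close>.\<close>
  define err where "err m = b1 \<gamma> \<rho> * c1 S * K 0 / (\<Sum>n\<in>W. K n) + b2 \<gamma> \<rho> * c2 S * m * K 0
    + b3 \<gamma> \<rho> * c3 S * K 0 / B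
    + b3 \<gamma> \<rho> * c4 S * K 0 * (\<Sum>n\<in>W. quant_var S n * (K n)^2) / (\<Sum>n\<in>W. K n)" for m
  have K: "K n > 0" if "n \<le> num_workers S" for n
    using True that by (auto simp: PiE_def Pi_def)
  have W: "finite W" "W \<noteq> {}"
    using S by (auto simp: W_def valid_system_def)
  have KW: "K n > 0" "cycles S n / freq S n * K n > 0" if "n \<in> W" for n
    using that S K[of n] by (auto simp: W_def valid_system_def)
  have K0: "K 0 > 0"
    using K by simp
  have l: "l > 0"
    using K0 \<rho> by (auto simp: l_def intro!: ln_gt_zero)
  \<comment> \<open>Positivity makes the maxima admissible values of \<open>T1\<close> and
    \<open>T2\<close>, and lets \<kappa> \<le> T2 be squared.\<close>
  have pos: "\<tau> > 0" "\<kappa> > 0"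
    using W KW by (auto simp: \<tau>_def \<kappa>_def Max_gr_iff)
  have bounds: "(\<forall>n\<in>W. cycles S n / freq S n * K n * inverse T1 \<le> 1) \<longleftrightarrow> \<tau> \<le> T1"
    "(\<forall>n\<in>W. K n * inverse T2 \<le> 1) \<longleftrightarrow> \<kappa> \<le> T2" if "T1 > 0" "T2 > 0" for T1 T2
  proof -
    have "x * inverse t \<le> 1 \<longleftrightarrow> x \<le> t" if "t > 0" for x t :: real
      using that by (simp add: divide_inverse [symmetric] pos_divide_le_eq)
    then show "(\<forall>n\<in>W. cycles S n / freq S n * K n * inverse T1 \<le> 1) \<longleftrightarrow> \<tau> \<le> T1"
      "(\<forall>n\<in>W. K n * inverse T2 \<le> 1) \<longleftrightarrow> \<kappa> \<le> T2"
      \<comment> \<open>The deleted rule would pull the quotient apart and destroy the shape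
        \<open>x * inverse t\<close>.\<close>
      using that W by (simp_all add: \<tau>_def \<kappa>_def del: times_divide_eq_left)
  qed
  have time': "(D + B * T1) * (K 0 / T_max S) \<le> 1 \<longleftrightarrow> K 0 * (D + B * T1) \<le> T_max S" for T1
    using S by (simp add: valid_system_def mult.commute)
  have P: "feasible_P S \<gamma> \<rho> (K, B) \<longleftrightarrow>
      K 0 * (D + B * \<tau>) \<le> T_max S \<and> err (\<kappa>^2) \<le> C_max S * K 0 * l"
  proof -
    have "(MAX n\<in>W. (K n)^2) = \<kappa>^2"
      unfolding \<kappa>_def using W KW(1) by (intro Max_power2_image) (auto intro: less_imp_le)
    then have "conv_error S \<gamma> \<rho> K B \<le> C_max S \<longleftrightarrow> err (\<kappa>^2) \<le> C_max S * K 0 * l"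
      unfolding conv_error_def err_def scaled_error_le_iff[OF K0 l]
      by (simp only: W_def l_def)
    moreover have "time_cost S K B = K 0 * (D + B * \<tau>)"
      by (simp add: time_cost_def D_def \<tau>_def W_def algebra_simps)
    ultimately show ?thesis
      using True by (simp add: feasible_P_def)
  qed
  have P': "feasible_P' S \<gamma> \<rho> (K, B, T1, T2) \<longleftrightarrow> T1 > 0 \<and> T2 > 0 \<and> \<tau> \<le> T1 \<and> \<kappa> \<le> T2 \<and>
      K 0 * (D + B * T1) \<le> T_max S \<and> err (T2^2) \<le> C_max S * K 0 * l" for T1 T2
    unfolding time'[symmetric]
    using True bounds[of T1 T2]
    by (auto simp: feasible_P'_def W_def D_def err_def l_def)
  have err_mono: "err m \<le> err m'" if "m \<le> m'" for m m'
  proof -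
    \<comment> \<open>This is the coefficient of \<open>m * K 0\<close> in \<open>err\<close>;
      \<gamma> enters \<open>b2\<close> only through its square.\<close>
    have "b2 \<gamma> \<rho> * c2 S \<ge> 0"
      using S \<rho> by (simp add: b2_def valid_system_def)
    then show ?thesis
      using K0 that by (simp add: err_def mult_left_mono mult_right_mono)
  qed
  show ?thesis
  proof
    assume "feasible_P S \<gamma> \<rho> (K, B)"
    then have "feasible_P' S \<gamma> \<rho> (K, B, \<tau>, \<kappa>)"
      using pos by (simp add: P P')
    then show "\<exists>T1 T2. feasible_P' S \<gamma> \<rho> (K, B, T1, T2)"
      by blast
  next
    assume "\<exists>T1 T2. feasible_P' S \<gamma> \<rho> (K, B, T1, T2)"
    then obtain T1 T2 where T: "\<tau> \<le> T1" "\<kappa> \<le> T2" "K 0 * (D + B * T1) \<le> T_max S"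
      "err (T2^2) \<le> C_max S * K 0 * l"
      by (auto simp: P')
    \<comment> \<open>Lowering \<open>T1\<close> to \<tau> and \<open>T2\<close> to \<kappa> only
      relaxes the time and error constraints.\<close>
    have "K 0 * (D + B * \<tau>) \<le> K 0 * (D + B * T1)"
      using T(1) K0 True by (simp add: mult_left_mono)
    moreover have "err (\<kappa>^2) \<le> err (T2^2)"
      using T(2) pos by (intro err_mono power_mono) auto
    ultimately show "feasible_P S \<gamma> \<rho> (K, B)"
      using T by (simp add: P)
  qed
qed

theorem theorem6:
  fixes S :: fl_system and \<gamma> \<rho> :: real
    and K :: "nat \<Rightarrow> real" and B T1 T2 :: real
  assumes "valid_system S"
    and "0 < \<gamma>" and "\<gamma> \<le> 1 / smoothness S"
    and "\<rho> > 0"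
    and "optimal_P' S \<gamma> \<rho> (K, B, T1, T2)"
  shows "optimal_P S \<gamma> \<rho> (K, B)"
proof -
  note iff = feasible_P_iff[OF assms(1,4)]
  show ?thesis
    \<comment> \<open>A cheaper feasible point of (P) would extend by \<open>iff\<close> to a point
      of (P') with the same energy, contradicting optimality there.\<close>
    using assms(5) unfolding optimal_P_def optimal_P'_def is_arg_min_def
    by (auto simp: iff)
qed

end
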